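(* Let $F$ be a finite field and let $p(x)\in F[x]$ be an admissible polynomial over $F$ of degree $q:=\deg(p(x))$. If $E,G\subset F$ satisfy $|E||G|>2(q+2)|F|^{2-(1/2^{q-1})}$, then there are $x,y\in F^*$ such that $xy\in E$ and $p(x)+y\in G$.
   Context: $F^*=F\setminus\{0\}$. A polynomial $p(x)\in F[x]$ is admissible for $F$ if it is non-constant and $\deg(p(x))\le\operatorname{char}(F)-1$. *)

theory Defs
  imports
    Complex_Main
    "HOL-Library.Cardinality"
    "HOL-Computational_Algebra.Computational_Algebra"
begin

text \<open>In a finite field the characteristic is a prime, so the subtraction below does not truncate.\<close>

definition admissible :: "'a::finite_field poly \<Rightarrow> bool" where
  "admissible p \<longleftrightarrow> degree p \<noteq> 0 \<and> degree p \<le> CHAR('a) - 1"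

end

theory Submission
  imports Defs "HOL-Number_Theory.Cong" "HOL-Analysis.Convex"
begin

text \<open>
  Write \<open>n\<close> for the size of the field \<open>F\<close>. Putting \<open>e = x y\<close>, the task is to find nonzero
  \<open>x\<close>, nonzero \<open>e \<in> E\<close> and \<open>g \<in> G\<close> with \<open>p(x) + e / x = g\<close>. Fix a nontrivial additive character
  \<open>\<psi>\<close> of \<open>F\<close>; one exists because a maximal additive subgroup avoiding \<open>1\<close> is a complement of
  the prime field. Detecting the equation by the frequencies \<open>t\<close> of \<open>\<psi>\<close>, the frequency \<open>0\<close>
  contributes \<open>(n - 1) |E - {0}| |G|\<close>, and if there is no solution, the nonzero frequencies must
  cancel it.

  They cannot do so when \<open>|E| |G|\<close> is large. By the Cauchy--Schwarz inequality over \<open>e\<close> and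
  orthogonality, the squared contribution of the nonzero frequencies is controlled by the Gram
  matrix of the vectors \<open>e \<mapsto> K(t, e) = \<Sum>x. \<psi>(t (p(x) + e / x))\<close>, where \<open>x\<close> runs through
  the nonzero elements. Summation over \<open>e\<close> forces the variable \<open>y\<close> of \<open>K(u, e)\<close> to be
  \<open>(u / t) x\<close>, so up to a factor \<open>n\<close> the entries of that matrix are the one-variable sums
  \<open>T(t, u) = \<Sum>x. \<psi>(t p(x) - u p((u / t) x))\<close>. This is why the equation is
  solved for \<open>g\<close> and not for \<open>e\<close>: the polynomial in the exponent has degree at most \<open>q\<close>,
  while the form \<open>e = x (g - p(x))\<close> would lead to degree \<open>q + 1\<close> and a weaker exponent.

  The leading coefficient of \<open>t p(x) - u p((u / t) x)\<close> vanishes only if \<open>u / t\<close> is a root of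
  unity of order dividing \<open>q + 1\<close>, which leaves at most \<open>q + 1\<close> exceptional entries in each
  row. All others have absolute value at most \<open>2 X\<close> with \<open>X\<close> equal to \<open>n\<close> to the power
  \<open>1 - 1 / 2^(q - 1)\<close>, by Weyl differencing (\<open>weyl_bound\<close>); here admissibility enters, since
  each differencing step lowers the degree by exactly one only below the characteristic. So the
  row sums are at most \<open>(n - 1) (q + 2 X)\<close> (\<open>sum_norm_correlation_poly_le\<close>), the Schur test
  turns them into a bound for the quadratic form, and the absence of solutions implies
  \<open>(n - 1) |E - {0}| |G| \<le> n\<^sup>2 (q + 2 X)\<close> (\<open>card_bound_if_no_solution\<close>). The hypothesis
  contradicts this, the factor \<open>2\<close> in it making up for \<open>n - 1\<close> in place of \<open>n\<close> and for
  the removal of \<open>0\<close> from \<open>E\<close>.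
\<close>

section \<open>Additive characters\<close>

locale additive_character =
  fixes \<psi> :: "'a::finite_field \<Rightarrow> complex"
  assumes psi_add: "\<psi> (x + y) = \<psi> x * \<psi> y"
    and norm_psi [simp]: "norm (\<psi> x) = 1"
    and psi_nontrivial: "\<exists>x. \<psi> x \<noteq> 1"

lemma of_nat_invertible_if_not_CHAR_dvd:
  assumes "\<not> CHAR('a::finite_field) dvd k"
  shows "\<exists>l. of_nat l * of_nat k = (1::'a)"
proof -
  have "prime CHAR('a)"
    by (intro prime_CHAR_semidom finite_imp_CHAR_pos) simp
  then have "coprime k CHAR('a)"
    using assms by (metis coprime_commute prime_imp_coprime)
  then obtain l where "[k * l = 1] (mod CHAR('a))"
    using cong_solve_coprime_nat by fastforce
  then have "of_nat (k * l) = (of_nat 1 :: 'a)"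
    by (simp only: of_nat_eq_iff_cong_CHAR)
  then show ?thesis
    by (metis mult.commute of_nat_1 of_nat_mult)
qed

text \<open>
  The subset \<open>H\<close> is a maximal additive subgroup avoiding \<open>1\<close>. If \<open>x\<close> lies outside it, then by
  maximality \<open>1 = h + k x\<close> with an integer \<open>k\<close> that is invertible in the prime field, so \<open>x\<close> is
  congruent modulo \<open>H\<close> to a multiple of \<open>1\<close>. Hence the quotient by \<open>H\<close> is cyclic of prime order,
  generated by the class of \<open>1\<close>, and a primitive root of unity gives a character trivial on \<open>H\<close>.
\<close>

lemma ex_additive_character:
  "\<exists>\<psi> :: 'a::finite_field \<Rightarrow> complex. additive_character \<psi>"
proof -
  define c where "c = CHAR('a)"
  have c: "prime c"
    unfolding c_def by (intro prime_CHAR_semidom finite_imp_CHAR_pos) simp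
  define additive where
    "additive = (\<lambda>H :: 'a set. 0 \<in> H \<and> (\<forall>x\<in>H. \<forall>y\<in>H. x + y \<in> H))"
  have mult_mem: "of_nat k * x \<in> H" if "additive H" "x \<in> H" for H x k
    using that by (induction k) (auto simp: additive_def algebra_simps)
  have "of_nat (c - 1) + 1 = (of_nat c :: 'a)"
    using prime_gt_0_nat[OF c] by (metis Suc_pred' add.commute of_nat_Suc)
  then have minus_one: "of_nat (c - 1) = (-1 :: 'a)"
    by (simp add: c_def eq_neg_iff_add_eq_0)
  have uminus_mem: "- x \<in> H" if "additive H" "x \<in> H" for H x
    using mult_mem[OF that, of "c - 1"] unfolding minus_one by simp
  have "\<exists>H \<in> {H. additive H \<and> 1 \<notin> H}. \<forall>H' \<in> {H. additive H \<and> 1 \<notin> H}. H \<subseteq> H' \<longrightarrow> H = H'"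
  proof (rule finite_has_maximal)
    have "additive {0}"
      by (simp add: additive_def)
    then show "{H. additive H \<and> 1 \<notin> H} \<noteq> {}"
      by force
  qed simp
  then obtain H where H: "additive H" "1 \<notin> H"
    and maximal: "\<And>H'. additive H' \<Longrightarrow> H \<subseteq> H' \<Longrightarrow> 1 \<notin> H' \<Longrightarrow> H = H'"
    by blast
  \<comment> \<open>Otherwise a multiple of \<open>of_nat k\<close> in \<open>H\<close> would be \<open>1\<close>.\<close>
  have not_mem: "of_nat k \<notin> H" if k: "\<not> c dvd k" for k
    using of_nat_invertible_if_not_CHAR_dvd[of k, where 'a = 'a] k mult_mem[OF H(1)] H(2)
    unfolding c_def by metis
  have "\<exists>j. x - of_nat j \<in> H" for x
  proof (cases "x \<in> H")
    case True
    then show ?thesis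
      by (metis diff_zero of_nat_0)
  next
    case False
    define H' where "H' = {h + of_nat k * x | h k. h \<in> H}"
    have "additive H'"
    proof -
      have "h + of_nat k * x + (h' + of_nat k' * x) \<in> H'" if "h \<in> H" "h' \<in> H" for h h' k k'
      proof -
        have "h + of_nat k * x + (h' + of_nat k' * x) = (h + h') + of_nat (k + k') * x"
          by (simp add: algebra_simps)
        then show ?thesis
          using that H(1) unfolding H'_def additive_def by blast
      qed
      moreover have "0 \<in> H'"
        using H(1) unfolding H'_def additive_def
        by (metis (mono_tags, lifting) add.right_neutral mem_Collect_eq mult_zero_left of_nat_0)
      ultimately show ?thesis
        unfolding additive_def by (auto simp: H'_def)
    qed
    moreover have "H \<subseteq> H'"
    proof
      fix h assume "h \<in> H"
      moreover have "h = h + of_nat 0 * x" by simp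
      ultimately show "h \<in> H'" unfolding H'_def by blast
    qed
    moreover have "x \<in> H'"
    proof -
      have "x = 0 + of_nat 1 * x" by simp
      then show ?thesis
        using H(1) unfolding H'_def additive_def by blast
    qed
    ultimately have "1 \<in> H'"
      using maximal False by blast
    then obtain h k where hk: "h \<in> H" "1 = h + of_nat k * x"
      unfolding H'_def by blast
    have "\<not> c dvd k"
    proof
      assume "c dvd k"
      then have "of_nat k = (0 :: 'a)"
        unfolding c_def by (simp add: of_nat_eq_0_iff_char_dvd)
      then show False
        using hk H(2) by simp
    qed
    then obtain l where l: "of_nat l * of_nat k = (1::'a)"
      unfolding c_def using of_nat_invertible_if_not_CHAR_dvd by blast
    have "of_nat l = of_nat l * (h + of_nat k * x)"
      using hk(2) by simp
    also have "\<dots> = of_nat l * h + x"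
      using l by (simp add: algebra_simps flip: mult.assoc)
    finally have "x - of_nat l = - (of_nat l * h)"
      by (metis add_diff_cancel_right' minus_diff_eq)
    then show ?thesis
      using uminus_mem[OF H(1) mult_mem[OF H(1) hk(1)]] by metis
  qed
  then obtain J where J: "\<And>x. x - of_nat (J x) \<in> H"
    by metis
  define \<omega> where "\<omega> = cis (2 * pi / real c)"
  have \<omega>_c: "\<omega> ^ c = 1"
    using prime_gt_0_nat[OF c] by (simp add: \<omega>_def DeMoivre)
  have \<omega>_power_eq: "\<omega> ^ i = \<omega> ^ j" if "x - of_nat i \<in> H" "x - of_nat j \<in> H" for x i j
  proof -
    \<comment> \<open>The difference \<open>i - j\<close> is written with \<open>c - 1\<close> for \<open>-1\<close> to stay in the naturals.\<close>
    have "- (x - of_nat i) + (x - of_nat j) \<in> H"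
      using that H(1) uminus_mem[OF H(1)] unfolding additive_def by blast
    moreover have "- (x - of_nat i) + (x - of_nat j) = of_nat (i + (c - 1) * j)"
      by (simp only: of_nat_add of_nat_mult minus_one) simp
    ultimately have "c dvd i + (c - 1) * j"
      using not_mem by metis
    then have "\<omega> ^ (i + (c - 1) * j) = 1"
      using \<omega>_c by (metis dvd_def power_mult power_one)
    moreover have "\<omega> ^ (j + (c - 1) * j) = 1"
      using \<omega>_c prime_gt_0_nat[OF c]
      by (metis One_nat_def Suc_pred mult_Suc power_mult power_one)
    ultimately have "\<omega> ^ i * \<omega> ^ ((c - 1) * j) = \<omega> ^ j * \<omega> ^ ((c - 1) * j)"
      by (simp add: power_add)
    then show ?thesis
      by (simp add: \<omega>_def)
  qed
  have "additive_character (\<lambda>x. \<omega> ^ J x)"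
  proof
    fix x y
    have "(x - of_nat (J x)) + (y - of_nat (J y)) \<in> H"
      using J H(1) unfolding additive_def by blast
    then have "x + y - of_nat (J x + J y) \<in> H"
      by (simp add: algebra_simps)
    then show "\<omega> ^ J (x + y) = \<omega> ^ J x * \<omega> ^ J y"
      using \<omega>_power_eq[OF J] by (metis power_add)
    show "norm (\<omega> ^ J x) = 1"
      by (simp add: \<omega>_def norm_power)
  next
    have "1 - of_nat 1 \<in> H"
      using H(1) by (simp add: additive_def)
    then have "\<omega> ^ J 1 = \<omega>"
      using \<omega>_power_eq[OF J, of 1 1] by simp
    moreover have "\<omega> \<noteq> 1"
    proof
      assume "\<omega> = 1"
      then have "cos (2 * pi / real c) = 1"
        by (simp add: \<omega>_def complex_eq_iff)
      then obtain k :: int where "2 * pi / real c = of_int k * 2 * pi"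
        using cos_one_2pi_int by blast
      then have "1 = of_int k * real c"
        using prime_gt_0_nat[OF c] by (simp add: field_simps)
      then have "1 = k * int c"
        by (metis of_int_1 of_int_eq_iff of_int_mult of_int_of_nat_eq)
      then have "int c dvd 1"
        by (metis dvd_triv_right)
      then show False
        using prime_gt_1_nat[OF c] by simp
    qed
    ultimately show "\<exists>x. \<omega> ^ J x \<noteq> 1"
      by metis
  qed
  then show ?thesis
    by blast
qed

context additive_character
begin

lemma psi_0 [simp]: "\<psi> 0 = 1"
proof -
  have "\<psi> 0 \<noteq> 0"
    using norm_psi[of 0] by force
  then show ?thesis
    using psi_add[of 0 0] by simp
qed

lemma psi_uminus: "\<psi> (- x) = cnj (\<psi> x)"
proof -
  have "\<psi> x * cnj (\<psi> x) = 1"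
    by (simp flip: complex_norm_square)
  moreover have "\<psi> x * \<psi> (- x) = 1"
    by (simp flip: psi_add)
  ultimately show ?thesis
    by (metis mult.commute mult.left_commute mult.right_neutral)
qed

lemma psi_diff: "\<psi> (x - y) = \<psi> x * cnj (\<psi> y)"
  by (metis diff_conv_add_uminus psi_add psi_uminus)

text \<open>Translating the summation variable multiplies the sum by a value of \<open>\<psi>\<close> other than \<open>1\<close>.\<close>

lemma sum_psi_mult:
  "(\<Sum>x\<in>UNIV. \<psi> (a * x)) = (if a = 0 then of_nat CARD('a) else 0)"
proof (cases "a = 0")
  case False
  obtain b where b: "\<psi> b \<noteq> 1"
    using psi_nontrivial by blast
  have "(\<Sum>x\<in>UNIV. \<psi> (a * x)) = (\<Sum>x\<in>UNIV. \<psi> (a * (x + b / a)))"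
    by (rule sum.reindex_bij_witness[of _ "\<lambda>x. x + b / a" "\<lambda>x. x - b / a"]) auto
  also have "\<dots> = (\<Sum>x\<in>UNIV. \<psi> (a * x)) * \<psi> b"
    using False by (simp add: distrib_left psi_add sum_distrib_right)
  finally show ?thesis
    using False b by simp
qed simp

end

section \<open>Weyl differencing\<close>

lemma coeff_pcompose_shift_top:
  fixes f :: "'a::comm_ring_1 poly"
  assumes "degree f \<le> n"
  shows "coeff (pcompose f [:h, 1:]) n = coeff f n"
  using assms
proof (induction f arbitrary: n)
  case (pCons a f)
  show ?case
  proof (cases "f = 0")
    case False
    then obtain m where m: "n = Suc m" "degree f \<le> m"
      using pCons.prems by (cases n) auto
    then show ?thesis
      using pCons.IH[of m] pCons.IH[of "Suc m"]
      by (simp add: pcompose_pCons coeff_eq_0)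
  qed (auto simp: pcompose_pCons)
qed simp

lemma coeff_pcompose_shift_second:
  fixes f :: "'a::comm_ring_1 poly"
  assumes "degree f \<le> Suc n"
  shows "coeff (pcompose f [:h, 1:]) n = coeff f n + of_nat (Suc n) * h * coeff f (Suc n)"
  using assms
proof (induction f arbitrary: n)
  case (pCons a f)
  show ?case
  proof (cases "f = 0")
    case False
    then have deg: "degree f \<le> n"
      using pCons.prems by simp
    show ?thesis
    proof (cases n)
      case 0
      then show ?thesis
        using coeff_pcompose_shift_top[of f 0 h] deg
        by (simp add: pcompose_pCons)
    next
      case (Suc m)
      then show ?thesis
        using pCons.IH[of m] coeff_pcompose_shift_top[of f "Suc m" h] deg
        by (simp add: pcompose_pCons algebra_simps)
    qed
  qed (auto simp: pcompose_pCons)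
qed simp

text \<open>
  The top coefficients cancel, and the next one is \<open>(d + 1) h\<close> times the leading coefficient,
  which the assumption on the characteristic keeps from vanishing.
\<close>

lemma degree_difference:
  fixes f :: "'a::idom poly"
  assumes "degree f = Suc d" "\<not> CHAR('a) dvd Suc d" "h \<noteq> 0"
  shows "degree (pcompose f [:h, 1:] - f) = d"
proof (rule antisym)
  let ?g = "pcompose f [:h, 1:] - f"
  have "degree ?g \<le> Suc d"
    using assms(1) by (intro degree_diff_le) (auto simp: degree_pcompose)
  moreover have "coeff ?g (Suc d) = 0"
    using coeff_pcompose_shift_top[of f "Suc d" h] assms(1) by simp
  ultimately show "degree ?g \<le> d"
    by (metis le_SucE leading_coeff_0_iff degree_0 le0)
  have "coeff ?g d = of_nat (Suc d) * h * coeff f (Suc d)"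
    using coeff_pcompose_shift_second[of f d h] assms(1) by simp
  moreover have "of_nat (Suc d) \<noteq> (0 :: 'a)"
    using assms(2) of_nat_eq_0_iff_char_dvd by blast
  moreover have "coeff f (Suc d) \<noteq> 0"
    using assms(1) by (metis degree_0 leading_coeff_0_iff nat.distinct(1))
  ultimately show "d \<le> degree ?g"
    using assms(3) by (intro le_degree) simp
qed

context additive_character
begin

lemma norm_sum_psi_squared:
  fixes f :: "'a \<Rightarrow> 'a"
  shows "complex_of_real ((norm (\<Sum>x\<in>UNIV. \<psi> (f x)))\<^sup>2) =
     (\<Sum>h\<in>UNIV. \<Sum>x\<in>UNIV. \<psi> (f (x + h) - f x))"
proof -
  have "complex_of_real ((norm (\<Sum>x\<in>UNIV. \<psi> (f x)))\<^sup>2) =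
      (\<Sum>y\<in>UNIV. \<psi> (f y)) * (\<Sum>x\<in>UNIV. cnj (\<psi> (f x)))"
    by (simp only: complex_norm_square cnj_sum)
  also have "\<dots> = (\<Sum>y\<in>UNIV. \<Sum>x\<in>UNIV. \<psi> (f y - f x))"
    by (simp add: sum_product psi_diff)
  also have "\<dots> = (\<Sum>x\<in>UNIV. \<Sum>y\<in>UNIV. \<psi> (f y - f x))"
    by (rule sum.swap)
  also have "\<dots> = (\<Sum>x\<in>UNIV. \<Sum>h\<in>UNIV. \<psi> (f (x + h) - f x))"
  proof (rule sum.cong)
    fix x
    show "(\<Sum>y\<in>UNIV. \<psi> (f y - f x)) = (\<Sum>h\<in>UNIV. \<psi> (f (x + h) - f x))"
      by (rule sum.reindex_bij_witness[of _ "\<lambda>h. x + h" "\<lambda>y. y - x"]) auto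
  qed simp
  also have "\<dots> = (\<Sum>h\<in>UNIV. \<Sum>x\<in>UNIV. \<psi> (f (x + h) - f x))"
    by (rule sum.swap)
  finally show ?thesis .
qed

text \<open>
  Squaring the sum gives one sum for each shift \<open>h\<close>, whose exponent has degree one less unless
  \<open>h = 0\<close>. For degree one the sum vanishes, and \<open>2 (X - 1)\<close> is \<open>0\<close> there as
  \<open>X = 1\<close>. This form is also stable under the recursion: with \<open>X\<close> and \<open>Y\<close> the powers
  for degrees \<open>d + 2\<close> and \<open>d + 1\<close>, one has \<open>X\<^sup>2 = n Y\<close>, and \<open>n + 2 n (Y - 1) = 2 X\<^sup>2 - n\<close> is
  at most \<open>4 (X - 1)\<^sup>2\<close> because the difference of the two is \<open>2 (X - 2)\<^sup>2 + n - 4\<close>.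
  A bound of the plain form \<open>2 X\<close> would leave too large a constant in \<open>theorem1p14\<close> when \<open>p\<close> is linear.
\<close>

lemma weyl_bound:
  assumes "CARD('a) \<ge> 4" "degree f = Suc d" "Suc d < CHAR('a)"
  shows "norm (\<Sum>x\<in>UNIV. \<psi> (poly f x)) \<le> 2 * (real CARD('a) powr (1 - 1 / 2 ^ d) - 1)"
  using assms(2,3)
proof (induction d arbitrary: f)
  case 0
  have "poly f x = coeff f 0 + coeff f 1 * x" for x
    using 0 by (simp add: poly_altdef)
  moreover have "coeff f 1 \<noteq> 0"
    using 0 by (metis One_nat_def degree_0 leading_coeff_0_iff nat.distinct(1))
  ultimately show ?case
    by (simp add: psi_add sum_psi_mult flip: sum_distrib_left)
next
  case (Suc d)
  define n where "n = real CARD('a)"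
  define X where "X = n powr (1 - 1 / 2 ^ Suc d)"
  define Y where "Y = n powr (1 - 1 / 2 ^ d)"
  define S where "S = norm (\<Sum>x\<in>UNIV. \<psi> (poly f x))"
  have n: "n \<ge> 4"
    using assms(1) by (simp add: n_def)
  have "n powr 0 \<le> n powr (1 - 1 / 2 ^ k)" for k :: nat
    using n by (intro powr_mono) auto
  then have X: "X \<ge> 1" and Y: "Y \<ge> 1"
    using n unfolding X_def Y_def by (metis powr_zero_eq_one not_numeral_le_zero)+
  have XY: "X\<^sup>2 = n * Y"
    using n by (simp add: X_def Y_def power2_eq_square powr_mult_base flip: powr_add)
  have deg: "degree (pcompose f [:h, 1:] - f) = Suc d" if "h \<noteq> 0" for h
    using that Suc.prems by (intro degree_difference) (auto dest: dvd_imp_le)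
  have "S\<^sup>2 = norm (\<Sum>h\<in>UNIV. \<Sum>x\<in>UNIV. \<psi> (poly f (x + h) - poly f x))"
    unfolding S_def norm_sum_psi_squared[symmetric] norm_of_real by simp
  also have "\<dots> \<le> (\<Sum>h\<in>UNIV. norm (\<Sum>x\<in>UNIV. \<psi> (poly f (x + h) - poly f x)))"
    by (rule norm_sum)
  also have "\<dots> = n + (\<Sum>h\<in>UNIV - {0}. norm (\<Sum>x\<in>UNIV. \<psi> (poly f (x + h) - poly f x)))"
    by (subst sum.remove[of _ 0]) (auto simp: n_def)
  also have "\<dots> \<le> n + (\<Sum>h\<in>UNIV - {0 :: 'a}. 2 * (Y - 1))"
  proof (rule add_left_mono, rule sum_mono)
    fix h :: 'a assume "h \<in> UNIV - {0}"
    then have "norm (\<Sum>x\<in>UNIV. \<psi> (poly (pcompose f [:h, 1:] - f) x)) \<le> 2 * (Y - 1)"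
      unfolding Y_def n_def using Suc.prems deg by (intro Suc.IH) auto
    then show "norm (\<Sum>x\<in>UNIV. \<psi> (poly f (x + h) - poly f x)) \<le> 2 * (Y - 1)"
      by (simp add: poly_pcompose add.commute)
  qed
  also have "(\<Sum>h\<in>UNIV - {0 :: 'a}. 2 * (Y - 1)) = (n - 1) * (2 * (Y - 1))"
    by (simp add: card_Diff_singleton n_def of_nat_diff)
  also have "n + (n - 1) * (2 * (Y - 1)) \<le> n + n * (2 * (Y - 1))"
    using Y by (intro add_left_mono mult_right_mono) auto
  also have "n + n * (2 * (Y - 1)) = 2 * X\<^sup>2 - n"
    by (simp add: XY algebra_simps)
  also have "\<dots> \<le> (2 * (X - 1))\<^sup>2"
  proof -
    have "(2 * (X - 1))\<^sup>2 - (2 * X\<^sup>2 - n) = 2 * (X - 2)\<^sup>2 + (n - 4)"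
      by (simp add: power2_eq_square algebra_simps)
    then show ?thesis
      using n by (smt (verit) zero_le_power2)
  qed
  finally have "S \<le> 2 * (X - 1)"
    by (rule power2_le_imp_le) (use X in simp)
  then show ?case
    by (simp add: S_def X_def n_def)
qed

end

section \<open>A large sieve for the incidence kernel\<close>

text \<open>
  The arithmetic--geometric mean inequality \<open>2 |A t| |A u| \<le> |A t|\<^sup>2 + |A u|\<^sup>2\<close> leaves only row
  sums and column sums of \<open>T\<close>, which agree by symmetry.
\<close>

lemma schur_test:
  fixes A :: "'b \<Rightarrow> complex" and T :: "'b \<Rightarrow> 'b \<Rightarrow> complex"
  assumes sym: "\<And>t u. t \<in> U \<Longrightarrow> u \<in> U \<Longrightarrow> norm (T t u) = norm (T u t)"
    and row: "\<And>t. t \<in> U \<Longrightarrow> (\<Sum>u\<in>U. norm (T t u)) \<le> R"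
  shows "norm (\<Sum>t\<in>U. \<Sum>u\<in>U. A t * cnj (A u) * T t u) \<le> R * (\<Sum>t\<in>U. (norm (A t))\<^sup>2)"
proof -
  define s where "s = (\<Sum>t\<in>U. \<Sum>u\<in>U. (norm (A t))\<^sup>2 * norm (T t u))"
  have s': "s = (\<Sum>t\<in>U. \<Sum>u\<in>U. (norm (A u))\<^sup>2 * norm (T t u))"
    unfolding s_def by (subst sum.swap) (auto simp: sym intro!: sum.cong)
  have "norm (\<Sum>t\<in>U. \<Sum>u\<in>U. A t * cnj (A u) * T t u) \<le>
      (\<Sum>t\<in>U. \<Sum>u\<in>U. norm (A t * cnj (A u) * T t u))"
    by (rule order_trans[OF norm_sum sum_mono[OF norm_sum]])
  also have "\<dots> \<le> (\<Sum>t\<in>U. \<Sum>u\<in>U.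
      ((norm (A t))\<^sup>2 * norm (T t u) + (norm (A u))\<^sup>2 * norm (T t u)) / 2)"
  proof (intro sum_mono)
    fix t u
    have "norm (A t) * norm (A u) \<le> ((norm (A t))\<^sup>2 + (norm (A u))\<^sup>2) / 2"
      using sum_squares_bound[of "norm (A t)" "norm (A u)"] by simp
    then have "norm (A t) * norm (A u) * norm (T t u) \<le>
        ((norm (A t))\<^sup>2 + (norm (A u))\<^sup>2) / 2 * norm (T t u)"
      by (rule mult_right_mono) simp
    then show "norm (A t * cnj (A u) * T t u) \<le>
        ((norm (A t))\<^sup>2 * norm (T t u) + (norm (A u))\<^sup>2 * norm (T t u)) / 2"
      by (simp add: norm_mult algebra_simps)
  qed
  also have "\<dots> = (s + s) / 2"
    by (subst (2) s') (simp add: s_def sum.distrib flip: sum_divide_distrib)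
  also have "\<dots> = s"
    by simp
  also have "\<dots> = (\<Sum>t\<in>U. (norm (A t))\<^sup>2 * (\<Sum>u\<in>U. norm (T t u)))"
    by (simp add: s_def sum_distrib_left)
  also have "\<dots> \<le> (\<Sum>t\<in>U. (norm (A t))\<^sup>2 * R)"
    by (intro sum_mono mult_left_mono row) auto
  finally show ?thesis
    by (simp add: sum_distrib_left mult.commute)
qed

context additive_character
begin

lemma parseval_indicator:
  "(\<Sum>t\<in>UNIV. (norm (\<Sum>g\<in>G. \<psi> (t * g)))\<^sup>2) = real CARD('a) * real (card G)"
proof -
  have "complex_of_real (\<Sum>t\<in>UNIV. (norm (\<Sum>g\<in>G. \<psi> (t * g)))\<^sup>2) =
      (\<Sum>t\<in>UNIV. (\<Sum>g\<in>G. \<psi> (t * g)) * (\<Sum>h\<in>G. cnj (\<psi> (t * h))))"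
    by (simp only: of_real_sum complex_norm_square cnj_sum)
  also have "\<dots> = (\<Sum>t\<in>UNIV. \<Sum>g\<in>G. \<Sum>h\<in>G. \<psi> ((g - h) * t))"
    by (simp add: sum_product psi_diff algebra_simps)
  also have "\<dots> = (\<Sum>g\<in>G. \<Sum>h\<in>G. \<Sum>t\<in>UNIV. \<psi> ((g - h) * t))"
    by (subst sum.swap, rule sum.cong[OF refl], rule sum.swap)
  also have "\<dots> = (\<Sum>g\<in>G. of_nat CARD('a))"
    by (intro sum.cong refl) (simp add: sum_psi_mult sum.delta)
  also have "\<dots> = complex_of_real (real CARD('a) * real (card G))"
    by simp
  finally show ?thesis
    by (simp only: of_real_eq_iff)
qed

text \<open>
  The Fourier transform in \<open>g\<close>, at frequency \<open>t\<close>, of the number of nonzero \<open>x\<close> that satisfy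
  \<open>P x + e / x = g\<close>.
\<close>

definition kernel :: "('a \<Rightarrow> 'a) \<Rightarrow> 'a \<Rightarrow> 'a \<Rightarrow> complex" where
  "kernel P t e = (\<Sum>x\<in>UNIV - {0}. \<psi> (t * (P x + e / x)))"

text \<open>
  The entries of the Gram matrix of the vectors \<open>kernel P t\<close>, up to the factor \<open>CARD('a)\<close>.
\<close>

definition correlation :: "('a \<Rightarrow> 'a) \<Rightarrow> 'a \<Rightarrow> 'a \<Rightarrow> complex" where
  "correlation P t u = (\<Sum>x\<in>UNIV - {0}. \<psi> (t * P x - u * P (u / t * x)))"

text \<open>
  In the product of the two kernels, \<open>e\<close> occurs only through \<open>\<psi> ((t / x - u / y) e)\<close>, and
  orthogonality selects the terms with \<open>y = (u / t) x\<close>.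
\<close>

lemma sum_kernel_mult_cnj_kernel:
  assumes "t \<noteq> 0" "u \<noteq> 0"
  shows "(\<Sum>e\<in>UNIV. kernel P t e * cnj (kernel P u e)) = of_nat CARD('a) * correlation P t u"
proof -
  let ?U = "UNIV - {0 :: 'a}"
  have "(\<Sum>e\<in>UNIV. kernel P t e * cnj (kernel P u e)) =
      (\<Sum>e\<in>UNIV. \<Sum>x\<in>?U. \<Sum>y\<in>?U. \<psi> (t * P x - u * P y) * \<psi> ((t / x - u / y) * e))"
    unfolding kernel_def cnj_sum sum_product
    by (intro sum.cong refl) (simp add: psi_add psi_diff algebra_simps diff_divide_distrib)
  also have "\<dots> =
      (\<Sum>x\<in>?U. \<Sum>y\<in>?U. \<Sum>e\<in>UNIV. \<psi> (t * P x - u * P y) * \<psi> ((t / x - u / y) * e))"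
    by (subst sum.swap, rule sum.cong[OF refl], rule sum.swap)
  also have "\<dots> = (\<Sum>x\<in>?U. \<Sum>y\<in>?U.
      if y = u / t * x then of_nat CARD('a) * \<psi> (t * P x - u * P y) else 0)"
  proof (intro sum.cong refl)
    fix x y assume "x \<in> ?U" "y \<in> ?U"
    then have "t / x - u / y = 0 \<longleftrightarrow> y = u / t * x"
      using assms by (auto simp: field_simps)
    then show "(\<Sum>e\<in>UNIV. \<psi> (t * P x - u * P y) * \<psi> ((t / x - u / y) * e)) =
        (if y = u / t * x then of_nat CARD('a) * \<psi> (t * P x - u * P y) else 0)"
      by (simp add: sum_psi_mult flip: sum_distrib_left)
  qed
  also have "\<dots> = (\<Sum>x\<in>?U. of_nat CARD('a) * \<psi> (t * P x - u * P (u / t * x)))"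
    using assms by (intro sum.cong refl) (simp add: sum.delta')
  finally show ?thesis
    by (simp add: correlation_def sum_distrib_left)
qed

text \<open>The substitution of \<open>(u / t) x\<close> for \<open>x\<close> exchanges the two terms of the exponent.\<close>

lemma norm_correlation_commute:
  assumes "t \<noteq> 0" "u \<noteq> 0"
  shows "norm (correlation P t u) = norm (correlation P u t)"
proof -
  have "correlation P u t = (\<Sum>x\<in>UNIV - {0}. \<psi> (u * P (u / t * x) - t * P (t / u * (u / t * x))))"
    unfolding correlation_def using assms
    by (intro sum.reindex_bij_witness[of _ "\<lambda>x. u / t * x" "\<lambda>x. t / u * x"]) auto
  also have "\<dots> = (\<Sum>x\<in>UNIV - {0}. \<psi> (- (t * P x - u * P (u / t * x))))"
    using assms by simp
  also have "\<dots> = cnj (correlation P t u)"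
    by (simp only: psi_uminus cnj_sum correlation_def)
  finally show ?thesis
    by simp
qed

lemma sum_norm_kernel_transform_squared_le:
  fixes A :: "'a \<Rightarrow> complex"
  defines "U \<equiv> UNIV - {0}"
  assumes row: "\<And>t. t \<in> U \<Longrightarrow> (\<Sum>u\<in>U. norm (correlation P t u)) \<le> R"
  shows "(\<Sum>e\<in>UNIV. (norm (\<Sum>t\<in>U. A t * kernel P t e))\<^sup>2) \<le>
           real CARD('a) * R * (\<Sum>t\<in>U. (norm (A t))\<^sup>2)"
proof -
  define s where "s = (\<Sum>e\<in>UNIV. (norm (\<Sum>t\<in>U. A t * kernel P t e))\<^sup>2)"
  have "complex_of_real s =
      (\<Sum>e\<in>UNIV. (\<Sum>t\<in>U. A t * kernel P t e) * (\<Sum>u\<in>U. cnj (A u * kernel P u e)))"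
    unfolding s_def by (simp only: of_real_sum complex_norm_square cnj_sum)
  also have "\<dots> = (\<Sum>e\<in>UNIV. \<Sum>t\<in>U. \<Sum>u\<in>U.
      A t * cnj (A u) * (kernel P t e * cnj (kernel P u e)))"
    by (simp add: sum_product mult_ac)
  also have "\<dots> = (\<Sum>t\<in>U. \<Sum>u\<in>U. \<Sum>e\<in>UNIV.
      A t * cnj (A u) * (kernel P t e * cnj (kernel P u e)))"
    by (subst sum.swap, rule sum.cong[OF refl], rule sum.swap)
  also have "\<dots> = (\<Sum>t\<in>U. \<Sum>u\<in>U. of_nat CARD('a) * (A t * cnj (A u) * correlation P t u))"
    by (intro sum.cong refl)
       (simp add: U_def sum_kernel_mult_cnj_kernel flip: sum_distrib_left)
  also have "\<dots> = of_nat CARD('a) * (\<Sum>t\<in>U. \<Sum>u\<in>U. A t * cnj (A u) * correlation P t u)"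
    by (simp only: sum_distrib_left)
  finally have "norm (complex_of_real s) =
      real CARD('a) * norm (\<Sum>t\<in>U. \<Sum>u\<in>U. A t * cnj (A u) * correlation P t u)"
    by (simp only: norm_mult norm_of_nat)
  then have "s \<le> real CARD('a) * norm (\<Sum>t\<in>U. \<Sum>u\<in>U. A t * cnj (A u) * correlation P t u)"
    using norm_of_real[of s, where 'a = complex] by linarith
  also have "\<dots> \<le> real CARD('a) * (R * (\<Sum>t\<in>U. (norm (A t))\<^sup>2))"
    by (intro mult_left_mono schur_test row)
       (auto simp: U_def intro: norm_correlation_commute)
  finally show ?thesis
    by (simp add: s_def mult.assoc)
qed

text \<open>
  Over all frequencies the sum is \<open>CARD('a)\<close> times the number of solutions, hence zero; what
  remains is minus the contribution of \<open>t = 0\<close>.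
\<close>

lemma sum_frequencies_if_no_solution:
  fixes E G :: "'a set"
  assumes "\<And>x e g. x \<noteq> 0 \<Longrightarrow> e \<in> E \<Longrightarrow> g \<in> G \<Longrightarrow> P x + e / x \<noteq> g"
  shows "(\<Sum>e\<in>E. \<Sum>t\<in>UNIV - {0}. cnj (\<Sum>g\<in>G. \<psi> (t * g)) * kernel P t e) =
           - of_real ((real CARD('a) - 1) * real (card E) * real (card G))"
proof -
  let ?U = "UNIV - {0 :: 'a}"
  let ?A = "\<lambda>t. cnj (\<Sum>g\<in>G. \<psi> (t * g))"
  let ?B = "\<lambda>e. \<Sum>t\<in>?U. ?A t * kernel P t e"
  have "?A t * kernel P t e = (\<Sum>g\<in>G. \<Sum>x\<in>?U. \<psi> ((P x + e / x - g) * t))" for t e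
    unfolding kernel_def cnj_sum sum_product
    by (intro sum.cong refl) (simp add: psi_diff algebra_simps)
  then have "(\<Sum>t\<in>UNIV. ?A t * kernel P t e) =
      (\<Sum>g\<in>G. \<Sum>x\<in>?U. \<Sum>t\<in>UNIV. \<psi> ((P x + e / x - g) * t))" for e
    by (simp only:) (subst sum.swap, rule sum.cong[OF refl], rule sum.swap)
  moreover have "(\<Sum>t\<in>UNIV. \<psi> ((P x + e / x - g) * t)) = 0"
    if "e \<in> E" "g \<in> G" "x \<in> ?U" for e g x
    using assms[of x e g] that by (simp add: sum_psi_mult)
  ultimately have "(\<Sum>t\<in>UNIV. ?A t * kernel P t e) = 0" if "e \<in> E" for e
    using that by simp
  moreover have "(\<Sum>t\<in>UNIV. ?A t * kernel P t e) =
      of_nat (card G) * of_nat (CARD('a) - 1) + ?B e" for e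
    by (subst sum.remove[of _ 0]) (auto simp: kernel_def card_Diff_singleton)
  ultimately have "?B e = - (of_nat (card G) * of_nat (CARD('a) - 1))" if "e \<in> E" for e
    using that by (simp only: eq_neg_iff_add_eq_0 add.commute)
  then have "(\<Sum>e\<in>E. ?B e) = (\<Sum>e\<in>E. - (of_nat (card G) * of_nat (CARD('a) - 1)))"
    by (rule sum.cong[OF refl])
  also have "\<dots> = - of_real ((real CARD('a) - 1) * real (card E) * real (card G))"
    by (simp add: of_nat_diff)
  finally show ?thesis .
qed

text \<open>
  The Cauchy--Schwarz inequality is applied over \<open>e \<in> E\<close>, after which the sum can be extended to
  all \<open>e\<close>, where orthogonality is available; this costs the factor \<open>card E\<close>. The Parseval
  identity for the indicator of \<open>G\<close> supplies the factor \<open>card G\<close>. One copy of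
  \<open>card E * card G\<close> then cancels.
\<close>

lemma card_bound_if_no_solution:
  fixes E G :: "'a set"
  assumes "\<And>x e g. x \<noteq> 0 \<Longrightarrow> e \<in> E \<Longrightarrow> g \<in> G \<Longrightarrow> P x + e / x \<noteq> g"
    and row: "\<And>t. t \<noteq> 0 \<Longrightarrow> (\<Sum>u\<in>UNIV - {0}. norm (correlation P t u)) \<le> R"
    and "R \<ge> 0"
  shows "(real CARD('a) - 1)\<^sup>2 * (real (card E) * real (card G)) \<le> (real CARD('a))\<^sup>2 * R"
proof (cases "card E = 0 \<or> card G = 0")
  case True
  then show ?thesis
    using assms(3) by auto
next
  case False
  define n where "n = real CARD('a)"
  let ?U = "UNIV - {0 :: 'a}"
  let ?A = "\<lambda>t. cnj (\<Sum>g\<in>G. \<psi> (t * g))"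
  let ?B = "\<lambda>e. \<Sum>t\<in>?U. ?A t * kernel P t e"
  have "(\<Sum>e\<in>E. ?B e) = - of_real ((n - 1) * real (card E) * real (card G))"
    unfolding n_def using assms(1) by (rule sum_frequencies_if_no_solution)
  then have "((n - 1) * real (card E) * real (card G))\<^sup>2 = (norm (\<Sum>e\<in>E. ?B e))\<^sup>2"
    by (simp only: norm_minus_cancel norm_of_real power2_abs)
  also have "\<dots> \<le> (\<Sum>e\<in>E. norm (?B e))\<^sup>2"
    by (intro power_mono norm_sum) simp
  also have "\<dots> \<le> (\<Sum>e\<in>E. (norm (?B e))\<^sup>2) * real (card E)"
    by (rule sum_squared_le_sum_of_squares)
  also have "\<dots> \<le> (\<Sum>e\<in>UNIV. (norm (?B e))\<^sup>2) * real (card E)"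
    by (intro mult_right_mono sum_mono2) auto
  also have "\<dots> \<le> (n * R * (\<Sum>t\<in>?U. (norm (?A t))\<^sup>2)) * real (card E)"
    unfolding n_def using row
    by (intro mult_right_mono sum_norm_kernel_transform_squared_le) auto
  also have "\<dots> \<le> (n * R * (\<Sum>t\<in>UNIV. (norm (?A t))\<^sup>2)) * real (card E)"
    using assms(3) by (intro mult_right_mono mult_left_mono sum_mono2) (auto simp: n_def)
  also have "(\<Sum>t\<in>UNIV. (norm (?A t))\<^sup>2) = n * real (card G)"
    unfolding complex_mod_cnj parseval_indicator n_def ..
  finally have "((n - 1)\<^sup>2 * (real (card E) * real (card G))) * (real (card E) * real (card G)) \<le>
      (n\<^sup>2 * R) * (real (card E) * real (card G))"
    by (simp add: power2_eq_square mult_ac)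
  moreover have "real (card E) * real (card G) > 0"
    using False by (intro mult_pos_pos) auto
  ultimately show ?thesis
    unfolding n_def by (rule mult_right_le_imp_le)
qed

end

section \<open>Correlations of a polynomial\<close>

lemma card_roots_of_unity_le:
  assumes "n > 0"
  shows "card {r :: 'a::idom. r ^ n = 1} \<le> n"
proof -
  have "degree (monom 1 n - 1 :: 'a poly) \<le> n"
    by (intro degree_diff_le) (auto simp: degree_monom_le)
  moreover have "coeff (monom 1 n - 1 :: 'a poly) n = 1"
    using assms by (simp add: coeff_1)
  then have "monom 1 n - 1 \<noteq> (0 :: 'a poly)"
    by force
  then have "card {r :: 'a. poly (monom 1 n - 1) r = 0} \<le> degree (monom 1 n - 1 :: 'a poly)"
    by (rule card_poly_roots_bound)
  ultimately show ?thesis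
    by (simp add: poly_monom)
qed

context additive_character
begin

text \<open>
  The leading coefficient of the exponent is that of \<open>p\<close> times \<open>t (1 - (u / t)^(d + 2))\<close>.
  The bound exceeds that for complete sums by \<open>1\<close>, for the missing term \<open>x = 0\<close>.
\<close>

lemma norm_correlation_poly_le:
  assumes "CARD('a) \<ge> 4" "degree p = Suc d" "Suc d < CHAR('a)"
    and "t \<noteq> 0" "u \<noteq> 0" "(u / t) ^ Suc (Suc d) \<noteq> 1"
  shows "norm (correlation (poly p) t u) \<le> 2 * real CARD('a) powr (1 - 1 / 2 ^ d) - 1"
proof -
  let ?f = "smult t p - smult u (pcompose p [:0, u / t:])"
  have "degree ?f = Suc d"
  proof (rule antisym)
    show "degree ?f \<le> Suc d"
      using assms(2)
      by (intro degree_diff_le order_trans[OF degree_smult_le]) (auto simp: degree_pcompose)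
    have "lead_coeff (pcompose p [:0, u / t:]) = lead_coeff p * (u / t) ^ degree p"
      using assms(4,5) by (subst lead_coeff_comp) auto
    then have "coeff (pcompose p [:0, u / t:]) (Suc d) = lead_coeff p * (u / t) ^ Suc d"
      using assms(2,4,5) by (simp add: degree_pcompose)
    then have "coeff ?f (Suc d) = t * lead_coeff p * (1 - (u / t) ^ Suc (Suc d))"
      using assms(2,4) by (simp add: field_simps)
    moreover have "lead_coeff p \<noteq> 0"
      using assms(2) by (metis degree_0 leading_coeff_0_iff nat.distinct(1))
    ultimately show "Suc d \<le> degree ?f"
      using assms(4,6) by (intro le_degree) simp
  qed
  then have "norm (\<Sum>x\<in>UNIV. \<psi> (poly ?f x)) \<le> 2 * (real CARD('a) powr (1 - 1 / 2 ^ d) - 1)"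
    using assms(1,3) by (intro weyl_bound)
  moreover have "(\<Sum>x\<in>UNIV. \<psi> (poly ?f x)) = \<psi> (poly ?f 0) + correlation (poly p) t u"
    unfolding correlation_def
    by (subst sum.remove[of _ 0]) (auto simp: poly_pcompose mult.commute)
  then have "norm (correlation (poly p) t u) \<le> norm (\<Sum>x\<in>UNIV. \<psi> (poly ?f x)) + 1"
    using norm_triangle_ineq4[of "\<Sum>x\<in>UNIV. \<psi> (poly ?f x)" "\<psi> (poly ?f 0)"] by simp
  ultimately show ?thesis
    by simp
qed

lemma sum_norm_correlation_poly_le:
  assumes "CARD('a) \<ge> 4" "degree p = Suc d" "Suc d < CHAR('a)" "t \<noteq> 0"
  shows "(\<Sum>u\<in>UNIV - {0}. norm (correlation (poly p) t u)) \<le>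
           (real CARD('a) - 1) * (real (Suc d) + 2 * real CARD('a) powr (1 - 1 / 2 ^ d))"
proof -
  define n where "n = real CARD('a)"
  define X where "X = n powr (1 - 1 / 2 ^ d)"
  have "n powr 0 \<le> X"
    unfolding X_def n_def using assms(1) by (intro powr_mono) auto
  then have X: "X \<ge> 1"
    using assms(1) by (simp add: n_def)
  \<comment> \<open>The frequencies for which the exponent may degenerate; they get the trivial bound.\<close>
  define D where "D = {u \<in> UNIV - {0}. (u / t) ^ Suc (Suc d) = 1}"
  have card_U: "real (card (UNIV - {0 :: 'a})) = n - 1"
    by (simp add: card_Diff_singleton n_def of_nat_diff)
  have "card D \<le> card {r :: 'a. r ^ Suc (Suc d) = 1}"
    using assms(4) by (intro card_inj_on_le[of "\<lambda>u. u / t"]) (auto simp: D_def inj_on_def)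
  then have card_D: "card D \<le> Suc (Suc d)"
    using card_roots_of_unity_le[where n = "Suc (Suc d)" and 'a = 'a] by linarith
  have trivial: "norm (correlation (poly p) t u) \<le> n - 1" for u
  proof -
    have "norm (correlation (poly p) t u) \<le> (\<Sum>x\<in>UNIV - {0 :: 'a}. 1)"
      unfolding correlation_def by (rule order_trans[OF norm_sum]) simp
    then show ?thesis
      using card_U by simp
  qed
  have "(\<Sum>u\<in>UNIV - {0}. norm (correlation (poly p) t u)) \<le>
      (\<Sum>u\<in>UNIV - {0}. (if u \<in> D then n - 1 else 0) + (2 * X - 1))"
  proof (rule sum_mono)
    fix u :: 'a assume u: "u \<in> UNIV - {0}"
    show "norm (correlation (poly p) t u) \<le> (if u \<in> D then n - 1 else 0) + (2 * X - 1)"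
    proof (cases "u \<in> D")
      case True
      then show ?thesis
        using trivial[of u] X by simp
    next
      case False
      then have "(u / t) ^ Suc (Suc d) \<noteq> 1"
        using u by (simp only: D_def) blast
      then show ?thesis
        using norm_correlation_poly_le[OF assms(1-4), of u] u False
        by (simp del: power_Suc add: X_def n_def)
    qed
  qed
  also have "\<dots> = (n - 1) * real (card D) + (n - 1) * (2 * X - 1)"
  proof -
    have "D \<subseteq> UNIV - {0}"
      by (auto simp: D_def)
    then have "(\<Sum>u\<in>UNIV - {0}. if u \<in> D then n - 1 else 0) = (n - 1) * real (card D)"
      by (simp add: Int_absorb1 flip: sum.inter_restrict)
    then show ?thesis
      by (simp only: sum.distrib sum_constant card_U)
  qed
  also have "\<dots> \<le> (n - 1) * real (Suc (Suc d)) + (n - 1) * (2 * X - 1)"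
    using card_D assms(1) by (intro add_right_mono mult_left_mono) (auto simp: n_def)
  also have "\<dots> = (n - 1) * (real (Suc d) + 2 * X)"
    by (simp add: algebra_simps)
  finally show ?thesis
    by (simp add: n_def X_def)
qed

end

section \<open>Products and polynomial shifts\<close>

theorem theorem1p14:
  fixes p :: "'a::finite_field poly"
    and q :: nat
    and E G :: "'a set"
  assumes "admissible p"
    and "q = degree p"
    and "real (card E) * real (card G) >
           2 * (real q + 2) * real CARD('a) powr (2 - 1 / 2 ^ (q - 1))"
  shows "\<exists>x y. x \<in> UNIV - {0} \<and> y \<in> UNIV - {0} \<and> x * y \<in> E \<and> poly p x + y \<in> G"
proof (rule ccontr)
  assume no_solution: "\<not> ?thesis"
  define n where "n = real CARD('a)"
  define X where "X = n powr (1 - 1 / 2 ^ (q - 1))"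
  define s where "s = real q + 2"
  define m where "m = real (card E)"
  define k where "k = real (card G)"
  define E' where "E' = E - {0}"
  have "CHAR('a) > 0"
    by (intro finite_imp_CHAR_pos) simp
  then have q: "degree p = Suc (q - 1)" "Suc (q - 1) < CHAR('a)"
    using assms(1,2) by (auto simp: admissible_def)
  then have s: "s \<ge> 3"
    using assms(2) by (simp add: s_def)
  have "card {0, 1 :: 'a} \<le> CARD('a)"
    by (intro card_mono) auto
  then have n: "n \<ge> 2"
    by (simp add: n_def)
  have "n powr 0 \<le> X"
    unfolding X_def using n by (intro powr_mono) auto
  then have X: "X \<ge> 1"
    using n by simp
  have large: "m * k > 2 * s * (n * X)"
    using assms(3) n by (simp add: m_def k_def s_def X_def powr_mult_base flip: n_def)
  have mk: "0 \<le> m" "0 \<le> k" "m \<le> n" "k \<le> n"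
    by (auto simp: m_def k_def n_def card_mono)
  have m_ge: "m \<ge> 2 * s"
  proof -
    have "n * (2 * s) \<le> n * (2 * s * X)"
      using X s n by (intro mult_left_mono) auto
    also have "\<dots> < m * k"
      using large by (simp add: mult_ac)
    also have "\<dots> \<le> m * n"
      using mk by (intro mult_left_mono) auto
    finally show ?thesis
      using n by (simp add: mult.commute)
  qed
  then have n_ge: "n \<ge> 2 * s"
    using mk by simp
  obtain \<psi> :: "'a \<Rightarrow> complex" where "additive_character \<psi>"
    using ex_additive_character by blast
  then interpret additive_character \<psi> .
  have "poly p x + e / x \<noteq> g" if "x \<noteq> 0" "e \<in> E'" "g \<in> G" for x e g
  proof
    assume "poly p x + e / x = g"
    then have "x \<in> UNIV - {0} \<and> e / x \<in> UNIV - {0} \<and> x * (e / x) \<in> E \<and> poly p x + e / x \<in> G"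
      using that by (simp add: E'_def)
    then show False
      using no_solution by blast
  qed
  moreover have "(\<Sum>u\<in>UNIV - {0}. norm (correlation (poly p) t u)) \<le> (n - 1) * (real q + 2 * X)"
    if "t \<noteq> 0" for t
  proof -
    have "CARD('a) \<ge> 4"
      using n_ge s by (simp add: n_def)
    moreover have "Suc (q - 1) = q"
      using q(1) assms(2) by simp
    ultimately show ?thesis
      unfolding n_def X_def using sum_norm_correlation_poly_le[OF _ q that] by (simp only:)
  qed
  moreover have "(n - 1) * (real q + 2 * X) \<ge> 0"
    using n X by (intro mult_nonneg_nonneg) auto
  ultimately have "(n - 1)\<^sup>2 * (real (card E') * k) \<le> n\<^sup>2 * ((n - 1) * (real q + 2 * X))"
    unfolding n_def k_def by (rule card_bound_if_no_solution)
  then have "(n - 1) * (real (card E') * k) \<le> n\<^sup>2 * (real q + 2 * X)"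
    using n by (simp add: power2_eq_square)
  also have "\<dots> \<le> n\<^sup>2 * (s * X)"
  proof (rule mult_left_mono)
    have "real q * 1 \<le> real q * X"
      using X by (intro mult_left_mono) auto
    then show "real q + 2 * X \<le> s * X"
      by (simp add: s_def algebra_simps)
  qed simp
  also have "\<dots> < n * (m * k / 2)"
    using large n by (simp add: power2_eq_square mult_ac)
  finally have upper: "(n - 1) * (real (card E') * k) < n * (m * k / 2)" .
  \<comment> \<open>As \<open>m\<close> and \<open>n\<close> are at least \<open>2 s \<ge> 6\<close>, lowering each by one costs at most a factor
    \<open>5 / 6\<close>, and \<open>25 / 36\<close> still exceeds the \<open>1 / 2\<close> of the upper bound.\<close>
  have "n * m * (25 / 36) = (5 / 6 * n) * (5 / 6 * m)"
    by simp
  also have "\<dots> \<le> (n - 1) * (m - 1)"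
    using m_ge n_ge s by (intro mult_mono) auto
  also have "\<dots> \<le> (n - 1) * real (card E')"
    using n unfolding E'_def m_def by (intro mult_left_mono) (auto simp: card_Diff_singleton_if)
  finally have "n * m * (25 / 36) * k \<le> (n - 1) * real (card E') * k"
    using mk by (intro mult_right_mono)
  with upper have "n * (m * k) * (25 / 36) < n * (m * k) * (1 / 2)"
    by (simp add: mult_ac)
  moreover have "0 \<le> n * (m * k)"
    using n mk by simp
  ultimately show False
    by linarith
qed

end
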